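(* Let $p$ be an odd prime, $r\ge1$, and $0\le i<k<2r$ such that $h(x)=x^{p^i+p^k}$ is planar on $\mathbb{F}_{p^{2r}}$. Let $f_1(x)=x^2+x^{2p^r}+h(x)-h(x)^{p^r}$. If either $r$ is even or $p\equiv1\pmod4$, then $f_1$ is CCZ-equivalent to a generalized Budaghyan–Helleseth function on $\mathbb{F}_{p^{2r}}$.
   Context: A generalized Budaghyan–Helleseth function on $\mathbb{F}_{p^{2r}}$ is a function $B(x)=x^{p^r+1}+\omega\beta x^{p^s+1}+\omega\beta^{p^r}x^{(p^s+1)p^r}$, where $s$ is an integer, $\omega,\beta\in\mathbb{F}_{p^{2r}}$ with $\omega+\omega^{p^r}=0$, $\beta^{p^r-1}$ does not lie in the subgroup of $\mathbb{F}_{p^{2r}}^*$ of order $(p^r+1)/\gcd(p^r+1,p^s+1)$, and $x^{p^s}\ne -x$ for all $x\in\mathbb{F}_{p^{2r}}^*$. A function $f$ is planar if $x\mapsto f(x+a)-f(x)$ is a bijection for every $a\ne0$. Functions $F,G$ on $\mathbb{F}_q$ are CCZ-equivalent if an affine permutation of $\mathbb{F}_q\times\mathbb{F}_q$ (over the prime field) maps the graph of $F$ onto the graph of $G$. *)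

theory Defs
  imports
    "HOL-Algebra.Algebraic_Closure_Type"
    "HOL-Algebra.Multiplicative_Group"
    "HOL-Number_Theory.Cong"
    "HOL-Library.Cardinality"
    "HOL-Library.Product_Plus"
begin

definition planar :: "('a::field \<Rightarrow> 'a) \<Rightarrow> bool" where
  "planar f \<longleftrightarrow> (\<forall>a. a \<noteq> 0 \<longrightarrow> bij (\<lambda>x. f (x + a) - f x))"

text \<open>
  In a field of prime characteristic the prime field is the image of the canonical map from
  the integers.
\<close>

definition prime_field :: "'a::field set" where
  "prime_field = range of_int"

definition prime_linear :: "('a::field \<times> 'a \<Rightarrow> 'a \<times> 'a) \<Rightarrow> bool" where
  "prime_linear L \<longleftrightarrow> additive L \<and>
     (\<forall>c\<in>prime_field. \<forall>x y. L (c * x, c * y) = (c * fst (L (x, y)), c * snd (L (x, y))))"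

definition prime_affine :: "('a::field \<times> 'a \<Rightarrow> 'a \<times> 'a) \<Rightarrow> bool" where
  "prime_affine A \<longleftrightarrow> (\<exists>L c. prime_linear L \<and> A = (\<lambda>z. L z + c))"

definition graph_of :: "('a \<Rightarrow> 'b) \<Rightarrow> ('a \<times> 'b) set" where
  "graph_of F = range (\<lambda>x. (x, F x))"

definition CCZ_equivalent :: "('a::field \<Rightarrow> 'a) \<Rightarrow> ('a \<Rightarrow> 'a) \<Rightarrow> bool" where
  "CCZ_equivalent F G \<longleftrightarrow> (\<exists>A. prime_affine A \<and> bij A \<and> A ` graph_of F = graph_of G)"

abbreviation mult_group :: "'a::field monoid" where
  "mult_group \<equiv> Multiplicative_Group.mult_of ring_of_type_algebra"

text \<open>
  The multiplicative group of a finite field is cyclic, so it has exactly one subgroup of each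
  order dividing the group order. The universally quantified \<open>H\<close> below therefore stands for
  the subgroup of the stated order. The exponent \<open>s\<close> is a natural number: replacing \<open>s\<close> by its
  residue modulo \<open>2 * r\<close> changes neither the function on the field with \<open>p ^ (2 * r)\<close> elements
  nor the greatest common divisor.
\<close>

definition generalized_BH :: "nat \<Rightarrow> nat \<Rightarrow> ('a::field \<Rightarrow> 'a) \<Rightarrow> bool" where
  "generalized_BH p r B \<longleftrightarrow>
     (\<exists>(s::nat) \<omega> \<beta>.
        \<omega> + \<omega> ^ (p ^ r) = 0 \<and>
        (\<forall>H. subgroup H (mult_group :: 'a monoid) \<and>
             card H = (p ^ r + 1) div gcd (p ^ r + 1) (p ^ s + 1) \<longrightarrow> \<beta> ^ (p ^ r - 1) \<notin> H) \<and>
        (\<forall>x::'a. x \<noteq> 0 \<longrightarrow> x ^ (p ^ s) \<noteq> - x) \<and>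
        B = (\<lambda>x. x ^ (p ^ r + 1) + \<omega> * \<beta> * x ^ (p ^ s + 1)
                 + \<omega> * \<beta> ^ (p ^ r) * x ^ ((p ^ s + 1) * p ^ r)))"

lemma ex1_subgroup_mult_group:
  assumes "m dvd CARD('a::{finite,field}) - 1"
  shows "\<exists>!H. subgroup H (mult_group :: 'a monoid) \<and> card H = m"
proof -
  let ?R = "ring_of_type_algebra :: 'a ring"
  let ?G = "Multiplicative_Group.mult_of ?R"
  let ?n = "CARD('a) - 1"
  let ?K = "{x::'a. x ^ m = 1}"
  interpret R: field ?R
    by (rule field_from_type_algebra)
  interpret G: group ?G
    by (rule R.field_mult_group)
  have sel: "carrier ?R = UNIV" "monoid.mult ?R = (*)" "\<one>\<^bsub>?R\<^esub> = 1" "\<zero>\<^bsub>?R\<^esub> = 0"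
    by (auto simp: ring_of_type_algebra_def)
  have pw: "x [^]\<^bsub>?R\<^esub> k = x ^ k" for x :: 'a and k :: nat
    by (induction k) (simp_all add: sel mult.commute)
  have pwG: "x [^]\<^bsub>?G\<^esub> k = x ^ k" for x :: 'a and k :: nat
    by (simp add: Multiplicative_Group.nat_pow_mult_of pw)
  have ord: "Coset.order ?G = ?n"
    by (simp add: Coset.order_def sel card_Diff_singleton)
  have "card {0, 1 :: 'a} \<le> CARD('a)"
    by (rule card_mono) auto
  hence n: "?n > 0"
    by simp
  hence m: "m > 0"
    using assms by (auto intro: Nat.gr0I)
  have Kle: "card ?K \<le> m"
    using R.num_roots_le_deg[of m] m by (simp add: sel pw)
  have sub: "H \<subseteq> ?K" if "subgroup H ?G" "card H = m" for H
  proof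
    fix x assume x: "x \<in> H"
    interpret H: group "?G\<lparr>carrier := H\<rparr>"
      using that(1) by (rule G.subgroup_imp_group)
    have "x [^]\<^bsub>?G\<lparr>carrier := H\<rparr>\<^esub> Coset.order (?G\<lparr>carrier := H\<rparr>) = \<one>\<^bsub>?G\<lparr>carrier := H\<rparr>\<^esub>"
      by (rule H.pow_order_eq_1) (use x in simp)
    moreover have "x [^]\<^bsub>?G\<lparr>carrier := H\<rparr>\<^esub> k = x ^ k" for k :: nat
      using pwG[of x k] by (simp add: nat_pow_def)
    ultimately show "x \<in> ?K"
      using that(2) by (simp add: Coset.order_def sel)
  qed
  have subgK: "subgroup ?K ?G"
  proof (rule G.subgroupI)
    show "?K \<subseteq> carrier ?G"
      using m by (auto simp: sel power_0_left)
    show "?K \<noteq> {}"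
      by (auto intro: exI[of _ 1])
  next
    fix a assume a: "a \<in> ?K"
    hence a0: "a \<noteq> 0"
      using m by (auto simp: power_0_left)
    have "inv\<^bsub>?G\<^esub> a = inverse a"
      by (rule G.inv_equality) (use a0 in \<open>auto simp: sel\<close>)
    thus "inv\<^bsub>?G\<^esub> a \<in> ?K"
      using a by (simp add: power_inverse)
  next
    fix a b assume "a \<in> ?K" "b \<in> ?K"
    thus "a \<otimes>\<^bsub>?G\<^esub> b \<in> ?K"
      by (simp add: sel power_mult_distrib)
  qed
  obtain g where g: "g \<in> carrier ?G" "carrier ?G = {g [^]\<^bsub>?R\<^esub> i | i::nat. i \<in> UNIV}"
    using R.finite_field_mult_group_has_gen by (auto simp: sel)
  have g1: "g ^ ?n = 1"
    using G.pow_order_eq_1[OF g(1)] by (simp add: ord pwG sel)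
  have gen: "carrier ?G = (\<lambda>i. g ^ i) ` {..<?n}"
  proof (intro equalityI subsetI)
    fix x assume "x \<in> carrier ?G"
    then obtain i :: nat where i: "x = g ^ i"
      using g(2) by (auto simp: pw)
    have "g ^ i = g ^ (?n * (i div ?n) + i mod ?n)"
      by simp
    also have "\<dots> = g ^ (i mod ?n)"
      by (simp only: power_add power_mult g1) simp
    finally show "x \<in> (\<lambda>i. g ^ i) ` {..<?n}"
      using i n by auto
  next
    fix x assume "x \<in> (\<lambda>i. g ^ i) ` {..<?n}"
    thus "x \<in> carrier ?G"
      using g(1) by (auto simp: sel)
  qed
  have inj: "inj_on (\<lambda>i. g ^ i) {..<?n}"
    by (rule eq_card_imp_inj_on) (use gen ord in \<open>simp_all add: Coset.order_def\<close>)
  obtain d where d: "?n = m * d"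
    using assms by (auto elim: dvdE)
  have d0: "d > 0"
    using d n by (auto intro: Nat.gr0I)
  have inj': "inj_on (\<lambda>j. g ^ (d * j)) {..<m}"
  proof (rule inj_onI)
    fix j k assume jk: "j \<in> {..<m}" "k \<in> {..<m}" "g ^ (d * j) = g ^ (d * k)"
    hence "d * j \<in> {..<?n}" "d * k \<in> {..<?n}"
      using d d0 by (auto simp: mult.commute)
    hence "d * j = d * k"
      using inj jk(3) by (auto dest: inj_onD)
    thus "j = k"
      using d0 by simp
  qed
  have "g ^ (d * j) \<in> ?K" for j
  proof -
    have "(g ^ (d * j)) ^ m = (g ^ ?n) ^ j"
      by (simp only: d power_mult [symmetric] mult_ac)
    thus ?thesis
      by (simp only: g1) simp
  qed
  hence "card ((\<lambda>j. g ^ (d * j)) ` {..<m}) \<le> card ?K"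
    by (intro card_mono) auto
  hence "card ?K = m"
    using Kle inj' by (simp add: card_image)
  show ?thesis
  proof (rule ex1I[of _ ?K])
    show "subgroup ?K ?G \<and> card ?K = m"
      using subgK \<open>card ?K = m\<close> by simp
    fix H assume "subgroup H ?G \<and> card H = m"
    thus "H = ?K"
      using sub \<open>card ?K = m\<close> by (intro card_subset_eq) auto
  qed
qed

end

theory Submission
  imports Defs "HOL-Number_Theory.Residues"
begin

text \<open>
  Put \<open>q = p ^ r\<close>. The last hypothesis says \<open>q = 1\<close> modulo 4, so \<open>-1\<close> has a square root \<open>\<iota>\<close> with
  \<open>\<iota> ^ q = \<iota>\<close>. Substituting \<open>x = y + \<iota> y ^ q\<close> turns \<open>x\<^sup>2 + x ^ (2 q)\<close> into \<open>4 \<iota> y ^ (q + 1)\<close>.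
  Planarity of \<open>h\<close> forbids \<open>\<iota> ^ (p ^ (k - i)) = - \<iota>\<close>, hence \<open>\<iota>\<close> has the same \<open>p ^ i\<close>-th and
  \<open>p ^ k\<close>-th power, and the cross terms cancel in \<open>h x - h x ^ q = 2 (h y - h y ^ q)\<close>. The two
  summands are fixed, respectively negated, by the \<open>q\<close>-th power map, so a linear map on the values can
  rescale them separately; with \<open>z = y ^ (p ^ i)\<close> this gives
  \<open>z ^ (q + 1) + z ^ (p ^ s + 1) - z ^ ((p ^ s + 1) q)\<close> where \<open>s = k - i\<close>, which is the
  Budaghyan--Helleseth function with \<open>\<beta> = 1 / \<omega>\<close>. Here \<open>\<beta> ^ (q - 1) = -1\<close>, which is outside the
  subgroup in question because its order is odd.
\<close>

text \<open>Multiplication by a nonzero \<open>x\<close> permutes the nonzero elements and so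
  preserves their product.\<close>

lemma power_CARD_eq_same:
  fixes x :: "'a::{finite,field}"
  shows "x ^ CARD('a) = x"
proof (cases "x = 0")
  case False
  have "(\<Prod>y\<in>UNIV-{0}. y) = (\<Prod>y\<in>UNIV-{0}. x * y)"
    by (rule prod.reindex_bij_witness[of _ "\<lambda>y. x * y" "\<lambda>y. y / x"]) (use False in auto)
  also have "\<dots> = x ^ (CARD('a) - 1) * (\<Prod>y\<in>UNIV-{0}. y)"
    by (simp add: prod.distrib card_Diff_singleton)
  finally have "x ^ (CARD('a) - 1) = 1"
    by simp
  thus ?thesis
    using power_minus_mult[of "CARD('a)" x] by simp
qed simp

lemma CHAR_eq_if_CARD_eq_power:
  assumes "prime p" and "CARD('a::{finite,field}) = p ^ m"
  shows "CHAR('a) = p"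
proof -
  have "CHAR('a) > 0"
    by (rule finite_imp_CHAR_pos) simp
  hence "prime CHAR('a)"
    by (rule prime_CHAR_semidom)
  moreover have "CHAR('a) dvd p ^ m"
    using CHAR_dvd_CARD[where 'a = 'a] assms(2) by simp
  ultimately show ?thesis
    using assms(1) by (metis prime_dvd_power primes_dvd_imp_eq)
qed

lemma additive_frobenius:
  assumes "prime p" and "CARD('a::{finite,field}) = p ^ m"
  shows "additive (\<lambda>x::'a. x ^ (p ^ n))"
  using CHAR_eq_if_CARD_eq_power[OF assms] assms(1)
  by (intro additive.intro freshmans_dream'[of _ n]) auto

text \<open>With \<open>m\<close> half the group order, \<open>x ^ m = 1\<close> has at most
  \<open>m\<close> roots among the \<open>2 * m\<close> nonzero elements; at a nonzero non-root the
  power squares to 1, so it is -1.\<close>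

lemma ex_power_half_eq_minus_one:
  assumes "odd CARD('a::{finite,field})"
  shows "\<exists>g::'a. g ^ ((CARD('a) - 1) div 2) = -1"
proof -
  let ?m = "(CARD('a) - 1) div 2"
  interpret R: field "ring_of_type_algebra :: 'a ring"
    by (rule field_from_type_algebra)
  have pw: "x [^]\<^bsub>ring_of_type_algebra\<^esub> k = x ^ k" for x :: 'a and k :: nat
    by (induction k) (simp_all add: ring_of_type_algebra_def mult.commute)
  have "card {0, 1 :: 'a} \<le> CARD('a)"
    by (rule card_mono) auto
  hence card: "CARD('a) = Suc (2 * ?m)" and m: "?m > 0"
    using assms by (auto elim!: oddE)
  have "card {x::'a. x ^ ?m = 1} \<le> ?m"
    using R.num_roots_le_deg[of ?m] m by (simp add: pw) (simp add: ring_of_type_algebra_def)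
  moreover have "card (UNIV - {0::'a}) = 2 * ?m"
    using card by (simp add: card_Diff_singleton)
  ultimately have "\<not> UNIV - {0} \<subseteq> {x::'a. x ^ ?m = 1}"
    using m card_mono[of "{x::'a. x ^ ?m = 1}" "UNIV - {0}"] by auto
  then obtain g :: 'a where g: "g \<noteq> 0" "g ^ ?m \<noteq> 1"
    by auto
  have "g * (g ^ ?m)\<^sup>2 = g ^ Suc (2 * ?m)"
    by (simp add: power_mult mult.commute flip: power_mult)
  also have "\<dots> = g"
    unfolding card[symmetric] by (rule power_CARD_eq_same)
  finally have "(g ^ ?m)\<^sup>2 = 1"
    using g(1) by simp
  thus ?thesis
    using g(2) by (auto simp: power2_eq_1_iff)
qed

lemma additive_mult_of_int:
  fixes f :: "'a::comm_ring_1 \<Rightarrow> 'a"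
  assumes "additive f"
  shows "f (of_int c * x) = of_int c * f x"
proof -
  interpret additive f by fact
  show ?thesis
    by (induction c rule: int_induct[of _ 0])
       (simp_all add: zero distrib_right left_diff_distrib add diff)
qed

lemma inj_additive:
  assumes "additive f" and "\<And>x. f x = 0 \<Longrightarrow> x = 0"
  shows "inj f"
proof (rule injI)
  fix x y assume "f x = f y"
  hence "f (x - y) = 0"
    using additive.diff[OF assms(1)] by simp
  thus "x = y"
    using assms(2)[of "x - y"] by simp
qed

text \<open>Block-diagonal case: \<open>N\<close> acts on arguments, \<open>M\<close> on values.
  Finiteness turns injectivity into bijectivity, and additivity already gives linearity over the
  prime field.\<close>

lemma CCZ_equivalentI:
  fixes F G N M :: "'a::{finite,field} \<Rightarrow> 'a"
  assumes N: "additive N" "inj N" and M: "additive M" "inj M"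
    and FG: "\<And>x. M (F x) = G (N x)"
  shows "CCZ_equivalent F G"
proof -
  let ?A = "\<lambda>z. (N (fst z), M (snd z))"
  have "additive ?A"
    by (rule additive.intro) (simp add: additive.add[OF N(1)] additive.add[OF M(1)])
  hence "prime_linear ?A"
    unfolding prime_linear_def prime_field_def
    by (auto simp: additive_mult_of_int[OF N(1)] additive_mult_of_int[OF M(1)])
  hence "prime_affine ?A"
    unfolding prime_affine_def by (intro exI[of _ ?A] exI[of _ 0]) simp
  moreover have "inj ?A"
    by (intro injI prod_eqI) (use N(2) M(2) in \<open>simp_all add: inj_eq\<close>)
  hence "bij ?A"
    by (simp add: bij_def finite_UNIV_inj_surj)
  moreover have "surj N"
    using N(2) by (simp add: finite_UNIV_inj_surj)
  hence "?A ` graph_of F = graph_of G"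
    using image_image[of "\<lambda>x. (x, G x)" N UNIV] by (simp add: graph_of_def image_image FG)
  ultimately show ?thesis
    unfolding CCZ_equivalent_def by blast
qed

text \<open>Lagrange's theorem; it keeps -1 out of a subgroup of odd order.\<close>

lemma subgroup_mult_group_power_card:
  fixes x :: "'a::{finite,field}"
  assumes H: "subgroup H (mult_group :: 'a monoid)" and "x \<in> H"
  shows "x ^ card H = 1"
proof -
  let ?G = "mult_group :: 'a monoid"
  interpret R: field "ring_of_type_algebra :: 'a ring"
    by (rule field_from_type_algebra)
  interpret G: group ?G
    by (rule R.field_mult_group)
  interpret H: group "?G\<lparr>carrier := H\<rparr>"
    using H by (rule G.subgroup_imp_group)
  have "x [^]\<^bsub>?G\<lparr>carrier := H\<rparr>\<^esub> k = x ^ k" for k :: nat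
    by (induction k) (simp_all add: ring_of_type_algebra_def mult.commute)
  thus ?thesis
    using H.pow_order_eq_1[of x] \<open>x \<in> H\<close> by (simp add: Coset.order_def ring_of_type_algebra_def)
qed

text \<open>Otherwise \<open>x ^ (p ^ k) = - (x ^ (p ^ i))\<close>, and the difference function in
  direction 1, which is \<open>x ^ (p ^ i) + x ^ (p ^ k) + 1\<close>, takes the same value at
  \<open>x\<close> and at 0.\<close>

lemma planar_monomial_imp_power_ne_minus:
  fixes x :: "'a::{finite,field}"
  assumes "prime p" and "odd p" and "CARD('a) = p ^ m" and "i \<le> k"
    and "planar (\<lambda>x::'a. x ^ (p ^ i + p ^ k))" and "x \<noteq> 0"
  shows "x ^ (p ^ (k - i)) \<noteq> - x"
proof
  assume eq: "x ^ (p ^ (k - i)) = - x"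
  note fr = additive.add[OF additive_frobenius[OF assms(1,3)]]
  have "x ^ (p ^ k) = (x ^ (p ^ (k - i))) ^ (p ^ i)"
    using \<open>i \<le> k\<close> by (simp flip: power_mult power_add)
  also have "\<dots> = - (x ^ (p ^ i))"
    using \<open>odd p\<close> by (simp add: eq)
  finally have "(x + 1) ^ (p ^ i + p ^ k) - x ^ (p ^ i + p ^ k) = (0 + 1) ^ (p ^ i + p ^ k) - 0 ^ (p ^ i + p ^ k)"
    using prime_gt_0_nat[OF \<open>prime p\<close>] by (simp add: power_add fr algebra_simps)
  moreover have "inj (\<lambda>x::'a. (x + 1) ^ (p ^ i + p ^ k) - x ^ (p ^ i + p ^ k))"
    using assms(5) unfolding planar_def bij_def by auto
  ultimately show False
    using \<open>x \<noteq> 0\<close> by (blast dest: injD[of _ x 0])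
qed

theorem theorem8:
  fixes p r i k :: nat
    and h f1 :: "'a::{finite,field} \<Rightarrow> 'a"
  assumes "prime p" and "odd p" and "r \<ge> 1"
    and "CARD('a) = p ^ (2 * r)"
    and "i < k" and "k < 2 * r"
    and "h = (\<lambda>x. x ^ (p ^ i + p ^ k))"
    and "planar h"
    and "f1 = (\<lambda>x. x ^ 2 + x ^ (2 * p ^ r) + h x - h x ^ (p ^ r))"
    and "even r \<or> [p = 1] (mod 4)"
  shows "\<exists>B :: 'a \<Rightarrow> 'a. generalized_BH p r B \<and> CCZ_equivalent f1 B"
proof -

  \<comment> \<open>Arithmetic of \<open>q\<close> and the Frobenius maps\<close>
  define q where "q = p ^ r"
  define n where "n = k - i"
  have card: "CARD('a) = q\<^sup>2"
    using assms(4) by (simp add: q_def power_mult mult.commute flip: power_mult)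
  have "odd q"
    using \<open>odd p\<close> by (simp add: q_def)
  \<comment> \<open>This settles the case of even \<open>r\<close>, where \<open>q\<close> is a
    power of the square of \<open>p\<close>.\<close>
  have "[p\<^sup>2 = 1] (mod 4)"
    using \<open>odd p\<close> by (auto elim!: oddE simp: cong_def power2_eq_square algebra_simps mod_Suc)
  hence "[q = 1] (mod 4)"
    using assms(10) cong_pow[of p 1 4 r] cong_pow[of "p\<^sup>2" 1 4 "r div 2"]
    by (auto simp: q_def simp flip: power_mult)
  hence "q = 4 * (q div 4) + 1"
    using mult_div_mod_eq[of 4 q] by (simp add: cong_def)
  then obtain t where t: "q = 4 * t + 1" ..
  have "\<not> p dvd 2"
    using \<open>odd p\<close> \<open>prime p\<close> by (metis primes_dvd_imp_eq two_is_prime_nat even_Suc)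
  hence two: "(2::'a) \<noteq> 0"
    using of_nat_eq_0_iff_char_dvd[of 2, where 'a = 'a] CHAR_eq_if_CARD_eq_power[OF assms(1,4)]
    by simp
  have four: "(4::'a) \<noteq> 0"
    using two by (metis mult_2 mult_eq_0_iff numeral_Bit0 mult_numeral_1_right)
  have eight: "(8::'a) \<noteq> 0"
    using two four by (metis mult_2 mult_eq_0_iff numeral_Bit0)

  note fr = additive_frobenius[OF assms(1,4)]
  have fr_q: "additive (\<lambda>x::'a. x ^ q)"
    unfolding q_def by (rule fr)
  have qq: "(x ^ q) ^ q = x" for x :: 'a
    using power_CARD_eq_same[of x] by (simp add: card power2_eq_square power_mult)
  have ne_minus: "x ^ (p ^ n) \<noteq> - x" if "x \<noteq> 0" for x :: 'a
    unfolding n_def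
    by (rule planar_monomial_imp_power_ne_minus[OF assms(1,2,4)]) (use assms that in auto)

  \<comment> \<open>\<open>\<iota>\<close> and \<open>\<omega>\<close> as powers of a
    nonsquare\<close>
  obtain g :: 'a where g: "g ^ ((CARD('a) - 1) div 2) = -1"
    using ex_power_half_eq_minus_one[where 'a = 'a] \<open>odd q\<close> card by auto
  have half: "(CARD('a) - 1) div 2 = 4 * t * (2 * t + 1)"
    by (simp add: card t power2_eq_square algebra_simps)
  \<comment> \<open>Half the exponent \<open>4 * t * (2 * t + 1)\<close> yields a square root of -1;
    the exponent \<open>2 * t + 1\<close> yields \<open>\<omega> ^ (q - 1) = -1\<close>, as
    \<open>q - 1 = 4 * t\<close>.\<close>
  define \<iota> where "\<iota> = g ^ (2 * t * (2 * t + 1))"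
  define \<omega> where "\<omega> = g ^ (2 * t + 1)"
  have \<iota>2: "\<iota> * \<iota> = -1"
    using g unfolding half \<iota>_def by (simp flip: power_add)
  have \<iota>q: "\<iota> ^ q = \<iota>"
    by (simp add: t power_mult power4_eq_xxxx \<iota>2 mult.assoc)
  have "\<omega> ^ q = g ^ (4 * t * (2 * t + 1)) * \<omega>"
    by (simp add: \<omega>_def t algebra_simps flip: power_mult power_add)
  hence \<omega>q: "\<omega> ^ q = - \<omega>"
    using g half by simp
  have "\<omega> \<noteq> 0"
    using g half two by (auto simp: \<omega>_def power_0_left split: if_splits)
  have \<iota>0: "\<iota> \<noteq> 0"
    using \<iota>2 by auto
  \<comment> \<open>Both \<open>\<iota> ^ (p ^ n)\<close> and \<open>\<iota>\<close> square to -1,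
    so they agree up to sign; \<open>ne_minus\<close> excludes the minus sign.\<close>
  have "(\<iota> ^ (p ^ n))\<^sup>2 = (\<iota> * \<iota>) ^ (p ^ n)"
    by (simp add: power2_eq_square power_mult_distrib)
  also have "\<dots> = \<iota>\<^sup>2"
    using \<open>odd p\<close> by (simp add: \<iota>2 power2_eq_square)
  finally have \<iota>n: "\<iota> ^ (p ^ n) = \<iota>"
    using ne_minus[OF \<iota>0] by (auto simp: power2_eq_iff)

  \<comment> \<open>The Budaghyan-Helleseth function\<close>
  define B where "B = (\<lambda>x::'a. x ^ (p ^ r + 1) + \<omega> * inverse \<omega> * x ^ (p ^ n + 1)
                 + \<omega> * inverse \<omega> ^ (p ^ r) * x ^ ((p ^ n + 1) * p ^ r))"
  have B_eq: "B x = x ^ q * x + x ^ (p ^ n) * x - (x ^ (p ^ n) * x) ^ q" for x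
  proof -
    have "\<omega> * inverse \<omega> ^ q = -1"
      using \<omega>q \<open>\<omega> \<noteq> 0\<close> by (simp add: power_inverse)
    moreover have "x ^ ((p ^ n + 1) * q) = (x ^ (p ^ n) * x) ^ q"
      by (simp add: power_mult mult.commute[of x] del: mult_Suc)
    ultimately show ?thesis
      using \<open>\<omega> \<noteq> 0\<close> by (simp add: B_def mult.commute[of x] flip: q_def)
  qed

  \<comment> \<open>Since \<open>q + 1 = 2 * (2 * t + 1)\<close> and the gcd is even, the subgroup
    order divides the odd number \<open>2 * t + 1\<close>.\<close>
  have "even (gcd (q + 1) (p ^ n + 1))"
    using \<open>odd q\<close> \<open>odd p\<close> by simp
  then obtain d where d: "gcd (q + 1) (p ^ n + 1) = 2 * d" ..
  hence "2 * d dvd q + 1"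
    by (metis gcd_dvd1)
  hence "2 * d * ((q + 1) div (2 * d)) = 2 * (2 * t + 1)"
    by (simp add: t)
  hence "d * ((q + 1) div (2 * d)) = 2 * t + 1"
    by simp
  hence "odd (d * ((q + 1) div (2 * d)))"
    by presburger
  hence odd_order: "odd ((q + 1) div (2 * d))"
    by simp
  have "inverse \<omega> ^ (q - 1) * inverse \<omega> = inverse \<omega> ^ q"
    using \<open>odd q\<close> by (metis odd_pos power_minus_mult)
  hence "inverse \<omega> ^ (q - 1) = -1"
    using \<omega>q \<open>\<omega> \<noteq> 0\<close> by (simp add: power_inverse field_simps)
  moreover have "(-1::'a) \<notin> H"
    if "subgroup H (mult_group :: 'a monoid)" "card H = (q + 1) div gcd (q + 1) (p ^ n + 1)" for H
    using subgroup_mult_group_power_card[OF that(1), of "-1"] that(2) odd_order two d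
    by (auto simp: minus_equation_iff eq_neg_iff_add_eq_0)
  moreover have "\<omega> + \<omega> ^ q = 0"
    by (simp add: \<omega>q)
  ultimately have "generalized_BH p r B"
    unfolding generalized_BH_def B_def q_def using ne_minus
    by (intro exI[of _ n] exI[of _ \<omega>] exI[of _ "inverse \<omega>"]) auto

  \<comment> \<open>The additive maps on arguments and values\<close>
  define Y where "Y = (\<lambda>x. (x - \<iota> * x ^ q) / 2)"
  define N where "N = (\<lambda>x. Y x ^ (p ^ i))"
  \<comment> \<open>\<open>u + u ^ q\<close> and \<open>u - u ^ q\<close> are twice the fixed and
    the negated part of \<open>u\<close>. At \<open>u = f1 x\<close> they turn out to be
    \<open>8 * \<iota> * (y * z)\<close> and \<open>4 * (a * c - a' * c')\<close>, hence the
    denominators; the power \<open>p ^ i\<close> carries the first part from \<open>y\<close> to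
    \<open>N x\<close>.\<close>
  define M where "M = (\<lambda>u. ((u + u ^ q) / (8 * \<iota>)) ^ (p ^ i) + (u - u ^ q) / 4)"
  note add_q = additive.add[OF fr_q] and diff_q = additive.diff[OF fr_q]
  have of_int_q: "(of_int c :: 'a) ^ q = of_int c" for c
    using additive_mult_of_int[OF fr_q, of c 1] by simp
  have num_q: "(2::'a) ^ q = 2" "(4::'a) ^ q = 4" "(8::'a) ^ q = 8"
    using of_int_q[of 2] of_int_q[of 4] of_int_q[of 8] by simp_all
  have pow_swap: "(x ^ m) ^ l = (x ^ l) ^ m" for x :: 'a and m l :: nat
    by (simp add: mult.commute flip: power_mult)

  \<comment> \<open>If \<open>x = y + \<iota> * y ^ q\<close>, then
    \<open>x - \<iota> * x ^ q = 2 * y\<close>; so \<open>Y\<close> inverts the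
    substitution.\<close>
  have Y: "x = Y x + \<iota> * Y x ^ q" for x
  proof -
    have "\<iota> * Y x ^ q = (\<iota> * x ^ q - \<iota> * \<iota> * x) / 2"
      by (simp add: Y_def power_divide diff_q power_mult_distrib \<iota>q qq num_q algebra_simps)
    thus ?thesis
      using two by (simp add: Y_def \<iota>2 field_simps)
  qed

  have "additive N"
    by (rule additive.intro)
       (simp add: N_def Y_def add_q additive.add[OF fr, symmetric] algebra_simps add_divide_distrib diff_divide_distrib)
  moreover have "inj N"
  proof (rule inj_additive)
    fix x assume "N x = 0"
    hence "Y x = 0"
      by (simp add: N_def)
    thus "x = 0"
      using Y[of x] \<open>odd q\<close> by (simp add: odd_pos)
  qed fact
  moreover have "additive M"
    by (rule additive.intro)
       (simp add: M_def add_q additive.add[OF fr, symmetric] algebra_simps add_divide_distrib diff_divide_distrib)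
  moreover have "inj M"
  proof (rule inj_additive)
    fix u assume "M u = 0"
    \<comment> \<open>The \<open>q\<close>-th power fixes the first summand of \<open>M u\<close>
      and negates the second, so \<open>M u = 0\<close> forces both to vanish.\<close>
    define A where "A = ((u + u ^ q) / (8 * \<iota>)) ^ (p ^ i)"
    have "A ^ q = A"
      unfolding A_def pow_swap[of _ "p ^ i" q]
      by (simp add: power_divide power_mult_distrib num_q \<iota>q add_q qq add.commute)
    moreover have "M u ^ q = A ^ q - (u - u ^ q) / 4"
      by (simp add: M_def A_def add_q diff_q power_divide num_q qq diff_divide_distrib)
    moreover have "M u = A + (u - u ^ q) / 4"
      by (simp add: M_def A_def)
    ultimately have *: "A - (u - u ^ q) / 4 = 0" "A + (u - u ^ q) / 4 = 0"
      using \<open>M u = 0\<close> additive.zero[OF fr_q] by metis+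
    have "2 * A = (A - (u - u ^ q) / 4) + (A + (u - u ^ q) / 4)"
      by simp
    also have "\<dots> = 0"
      by (simp only: *) simp
    finally have "A = 0"
      using two by simp
    hence "u - u ^ q = 0"
      using *(2) four by simp
    moreover have "u + u ^ q = 0"
      using \<open>A = 0\<close> eight \<iota>0 by (simp add: A_def)
    ultimately have "2 * u = 0"
      by (metis mult_2 right_minus_eq)
    thus "u = 0"
      using two by simp
  qed fact

  \<comment> \<open>The identity carrying \<open>f1\<close> to \<open>B\<close>\<close>
  moreover have "M (f1 x) = B (N x)" for x
  proof -
    define y z where "y = Y x" and "z = Y x ^ q"
    \<comment> \<open>Primes mark images under the \<open>q\<close>-th power, which swaps
      \<open>y\<close> and \<open>z\<close>; \<open>j\<close> is also the \<open>p ^ k\<close>-th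
      power of \<open>\<iota>\<close>.\<close>
    define a c a' c' j where "a = y ^ (p ^ i)" and "c = y ^ (p ^ k)"
      and "a' = z ^ (p ^ i)" and "c' = z ^ (p ^ k)" and "j = \<iota> ^ (p ^ i)"
    have pk: "w ^ (p ^ k) = (w ^ (p ^ n)) ^ (p ^ i)" for w :: 'a
      using \<open>i < k\<close> by (simp add: n_def flip: power_mult power_add)
    have x: "x = y + \<iota> * z"
      using Y[of x] by (simp add: y_def z_def)
    have yq: "y ^ q = z" and zq: "z ^ q = y"
      by (simp_all add: y_def z_def qq)
    have xq: "x ^ q = z + \<iota> * y"
      by (simp add: x add_q power_mult_distrib \<iota>q yq zq)
    have jj: "j * j = -1"
      using \<open>odd p\<close> by (simp add: j_def \<iota>2 flip: power_mult_distrib)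
    have jk: "\<iota> ^ (p ^ k) = j"
      by (simp add: pk \<iota>n j_def)
    have hx: "h x = (a + j * a') * (c + j * c')"
      by (simp add: assms(7) power_add x additive.add[OF fr] power_mult_distrib jk
          flip: a_def c_def a'_def c'_def j_def)
    have hxq: "h x ^ q = (a' + j * a) * (c' + j * c)"
      by (simp add: assms(7) power_add power_mult_distrib pow_swap[of x _ q] xq additive.add[OF fr] jk
          flip: a_def c_def a'_def c'_def j_def)
    have f1: "f1 x = (x\<^sup>2 + (x ^ q)\<^sup>2) + (h x - h x ^ q)"
      by (simp add: assms(9) q_def power_mult mult.commute[of 2])
    have f1q: "f1 x ^ q = (x\<^sup>2 + (x ^ q)\<^sup>2) - (h x - h x ^ q)"
      by (simp add: f1 add_q diff_q pow_swap[of _ 2 q] qq)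
    have "f1 x + f1 x ^ q = 2 * (x\<^sup>2 + (x ^ q)\<^sup>2)"
      unfolding f1q by (simp add: f1)
    \<comment> \<open>The squares of \<open>y\<close> and \<open>z\<close> drop out because
      \<open>1 + \<iota> * \<iota> = 0\<close>.\<close>
    also have "x\<^sup>2 + (x ^ q)\<^sup>2 = 4 * \<iota> * (y * z) + (1 + \<iota> * \<iota>) * (y\<^sup>2 + z\<^sup>2)"
      unfolding xq by (subst x) (simp add: power2_eq_square algebra_simps)
    also have "2 * \<dots> = 8 * \<iota> * (y * z)"
      by (simp add: \<iota>2)
    finally have s: "(f1 x + f1 x ^ q) / (8 * \<iota>) = y * z"
      using eight \<iota>0 by simp
    have "f1 x - f1 x ^ q = 2 * (h x - h x ^ q)"
      unfolding f1q by (simp add: f1)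
    \<comment> \<open>The mixed terms \<open>a * c'\<close> and \<open>a' * c\<close> carry the same
      factor \<open>j\<close> in \<open>h x\<close> and \<open>h x ^ q\<close>, so they cancel.
      Rewriting with \<open>hx\<close> first would destroy the left-hand side of
      \<open>hxq\<close>.\<close>
    also have "h x - h x ^ q = (1 - j * j) * (a * c - a' * c')"
      by (simp only: hxq, simp only: hx) (simp add: algebra_simps)
    also have "2 * \<dots> = 4 * (a * c - a' * c')"
      by (simp add: jj)
    finally have d: "(f1 x - f1 x ^ q) / 4 = a * c - a' * c'"
      using four by simp
    have "M (f1 x) = a * a' + (a * c - a' * c')"
      by (simp add: M_def s d power_mult_distrib a_def a'_def)
    moreover have "N x = a"
      by (simp add: N_def a_def y_def)
    moreover have "a ^ q = a'" "c ^ q = c'"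
      by (simp_all add: a_def a'_def c_def c'_def pow_swap[of y _ q] yq)
    moreover have "a ^ (p ^ n) = c"
      by (simp add: a_def c_def pk pow_swap[of y "p ^ i"])
    ultimately show ?thesis
      by (simp add: B_eq power_mult_distrib)
  qed
  ultimately have "CCZ_equivalent f1 B"
    by (rule CCZ_equivalentI)
  with \<open>generalized_BH p r B\<close> show ?thesis
    by blast
qed

end
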